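(* Let $\mathbf{X}$ be a Banach space and $\mathrm{F}\in\mathcal{F}_{\mathbf{X}}$. Let $\mathrm{Z}$ be a linear operator in $\mathbf{X}$ with domain $\mathcal{D}(\mathrm{Z})\subset\mathcal{D}(\mathrm{F}'(0))$ such that $\mathrm{Z}f=\mathrm{F}'(0)f$ for every $f\in\mathcal{D}(\mathrm{Z})$. Assume that $\mathbf{A}\subset\mathcal{D}(\mathrm{Z})$ is a dense linear subset of $\mathbf{X}$ and that there exists a fixed $l>0$ such that for each $f_0\in\mathbf{A}$ there exists a local solution $f:[0,l)\to\mathcal{D}(\overline{\mathrm{Z}})$ of the system $$f'(s)=\overline{\mathrm{Z}}f(s),\quad s\in[0,l),\qquad f(0)=f_0.$$ Then $\mathrm{Z}$ is closable and $\overline{\mathrm{Z}}$ is the generator of a $C_0$-semigroup $\mathrm{S}$. Furthermore, $$\mathrm{S}(t)f=\lim_{n\to\infty}\mathrm{F}(t/n)^n f,\qquad t\ge 0,$$ for all $f\in\mathbf{X}$ (norm limit).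
   Context: $\mathcal{L}(\mathbf{X})$ is the space of bounded linear operators on the Banach space $\mathbf{X}$ (over $\mathbb{R}$ or $\mathbb{C}$). For $\mathrm{S}:[0,\infty)\to\mathcal{L}(\mathbf{X})$, the (strong) derivative at $0$ is the linear operator $\mathrm{S}'(0)\psi=\lim_{h\to 0}h^{-1}(\mathrm{S}(h)\psi-\mathrm{S}(0)\psi)$ (norm limit, $h>0$), whose domain $\mathcal{D}(\mathrm{S}'(0))$ is the set of all $\psi\in\mathbf{X}$ for which the limit exists. The generator of a $C_0$-semigroup $\mathrm{S}$ is $\mathrm{S}'(0)$. $\mathcal{F}_{\mathbf{X}}$ is the set of all functions $\mathrm{F}:[0,\infty)\to\mathcal{L}(\mathbf{X})$ such that (i) $\mathrm{F}(0)=\mathrm{I}$ and there exist $M\ge 1$, $a\in\mathbb{R}$ with $\|\mathrm{F}(s/n)^m\|\le M\exp(\frac{am}{n}s)$ for all $n,m\in\mathbb{N}$, $s\ge 0$; (ii) $\mathcal{D}(\mathrm{F}'(0))$ is dense in $\mathbf{X}$. $\overline{\mathrm{Z}}$ denotes the closure of $\mathrm{Z}$; closability of $\mathrm{Z}$ (so that the hypothesis on local solutions makes sense) already follows from $\mathrm{F}\in\mathcal{F}_{\mathbf{X}}$ and $\mathrm{Z}\subset\mathrm{F}'(0)$. The derivative $f'$ is in the norm of $\mathbf{X}$ (one-sided at $s=0$). *)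

theory Defs
  imports "HOL-Analysis.Analysis"
begin

(* A Banach space over a scalar field 'k that is the reals or the complex numbers: by the
   Gelfand-Mazur theorem these are, up to isomorphism, the only instances of real_normed_field.
   A real Banach space is the case smul = scaleR. *)
locale banach_space_over = vector_space smul
  for smul :: "'k::real_normed_field \<Rightarrow> 'x::banach \<Rightarrow> 'x" +
  assumes scale_of_real: "smul (of_real r) x = r *\<^sub>R x"
    and norm_scale: "norm (smul c x) = norm c * norm x"

lemma banach_space_over_real:
  "banach_space_over (scaleR :: real \<Rightarrow> 'x::banach \<Rightarrow> 'x)"
  by unfold_locales (auto simp: algebra_simps)

lemma banach_space_over_complex:
  "banach_space_over ((*) :: complex \<Rightarrow> complex \<Rightarrow> complex)"
  by unfold_locales (auto simp: algebra_simps norm_mult scaleR_conv_of_real)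

(* Membership in L(X); boundedness over 'k and over the reals coincide. *)
definition bounded_operator :: "('k \<Rightarrow> 'x \<Rightarrow> 'x) \<Rightarrow> ('x::real_normed_vector \<Rightarrow> 'x) \<Rightarrow> bool" where
  "bounded_operator smul T \<longleftrightarrow>
     bounded_linear T \<and> (\<forall>c x. T (smul c x) = smul c (T x))"

(* A (possibly unbounded) operator T is represented by its graph: Domain T is its domain, and
   (x, y) \<in> T means x \<in> D(T) and T x = y.  Thus set inclusion is extension of operators, and set
   equality is equality of operators including their domains. *)
definition linear_operator :: "('k \<Rightarrow> 'x \<Rightarrow> 'x) \<Rightarrow> ('x::ab_group_add \<times> 'x) set \<Rightarrow> bool" where
  "linear_operator smul T \<longleftrightarrow>
     single_valued T \<and> (0, 0) \<in> T \<and>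
     (\<forall>x y u v. (x, y) \<in> T \<longrightarrow> (u, v) \<in> T \<longrightarrow> (x + u, y + v) \<in> T) \<and>
     (\<forall>c x y. (x, y) \<in> T \<longrightarrow> (smul c x, smul c y) \<in> T)"

(* The closure of an operator is the topological closure of its graph in the product space. *)
definition closable :: "('k \<Rightarrow> 'x \<Rightarrow> 'x) \<Rightarrow> ('x::real_normed_vector \<times> 'x) set \<Rightarrow> bool" where
  "closable smul T \<longleftrightarrow> linear_operator smul (closure T)"

(* Functions on [0, \<infinity>) are modelled as functions on the reals of which only the values at
   nonnegative arguments are used. *)
definition strong_deriv0 :: "(real \<Rightarrow> 'x \<Rightarrow> 'x) \<Rightarrow> ('x::real_normed_vector \<times> 'x) set" where
  "strong_deriv0 S = {(x, y). ((\<lambda>h. (S h x - S 0 x) /\<^sub>R h) \<longlongrightarrow> y) (at_right 0)}"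

definition class_F :: "('k \<Rightarrow> 'x \<Rightarrow> 'x) \<Rightarrow> (real \<Rightarrow> 'x::real_normed_vector \<Rightarrow> 'x) set" where
  "class_F smul = {F.
     (\<forall>s\<ge>0. bounded_operator smul (F s)) \<and>
     F 0 = id \<and>
     (\<exists>M\<ge>1. \<exists>a. \<forall>n\<ge>1. \<forall>m\<ge>1. \<forall>s\<ge>0.
        onorm (F (s / real n) ^^ m) \<le> M * exp (a * real m / real n * s)) \<and>
     closure (Domain (strong_deriv0 F)) = UNIV}"

definition C0_semigroup :: "('k \<Rightarrow> 'x \<Rightarrow> 'x) \<Rightarrow> (real \<Rightarrow> 'x::real_normed_vector \<Rightarrow> 'x) \<Rightarrow> bool" where
  "C0_semigroup smul S \<longleftrightarrow>
     (\<forall>t\<ge>0. bounded_operator smul (S t)) \<and>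
     S 0 = id \<and>
     (\<forall>s\<ge>0. \<forall>t\<ge>0. S (s + t) = S s \<circ> S t) \<and>
     (\<forall>x. continuous_on {0..} (\<lambda>t. S t x))"

definition is_generator_of :: "('x::real_normed_vector \<times> 'x) set \<Rightarrow> (real \<Rightarrow> 'x \<Rightarrow> 'x) \<Rightarrow> bool" where
  "is_generator_of A S \<longleftrightarrow> A = strong_deriv0 S"

(* f is a solution on [0, l) of f' = T f, f(0) = x0, for an operator T given by its graph;
   the derivative within [0, l) is two-sided for s > 0 and one-sided at s = 0. *)
definition local_solution ::
    "('x::real_normed_vector \<times> 'x) set \<Rightarrow> real \<Rightarrow> 'x \<Rightarrow> (real \<Rightarrow> 'x) \<Rightarrow> bool" where
  "local_solution T l x0 f \<longleftrightarrow>
     f 0 = x0 \<and>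
     (\<forall>s\<in>{0..<l}. \<exists>y. (f s, y) \<in> T \<and> (f has_vector_derivative y) (at s within {0..<l}))"

end

theory Submission
  imports Defs
begin

text \<open>
  Telescoping the powers of \<open>F h\<close> shows that every \<open>(x, y)\<close> in the closure of \<open>F'(0)\<close> satisfies
  \<open>F(h)^m x = x + r y + o(r)\<close> when \<open>h\<close> tends to \<open>0\<close> and \<open>m h\<close> to \<open>r\<close>. Hence the powers
  \<open>F(h)^\<lfloor>t/h\<rfloor> f(0)\<close> converge to \<open>f(t)\<close> along every solution \<open>f\<close>; a compactness argument on the
  interval replaces integration, because \<open>f'\<close> need not be continuous. Density of the initial values
  and multiplication of the limits then give convergence for all \<open>t\<close> on the whole space, to a
  \<open>C\<^sub>0\<close>-semigroup \<open>S\<close>. The first-order expansion passes to the limit and shows that the closure of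
  \<open>Z\<close> is contained in \<open>S'(0)\<close>, so \<open>Z\<close> is closable. Conversely, integrating solutions inside the
  closed graph puts \<open>(\<integral>\<^sub>0\<^sup>t S(s)x ds, S(t)x - x)\<close> into the closure of \<open>Z\<close> for all \<open>x\<close>, and dividing
  by \<open>t\<close> gives the other inclusion.
\<close>

section \<open>Counting steps of length \<open>h\<close>\<close>

text \<open>One step length \<open>h\<close> shared by all times makes the powers of
  \<open>F h\<close> at different times composable. For positive \<open>t\<close> and
  \<open>n\<close>, the choice \<open>h = t / n\<close> gives back exactly \<open>n\<close>
  steps.\<close>

definition steps :: "real \<Rightarrow> real \<Rightarrow> nat" where
  "steps t h = nat \<lfloor>t / h\<rfloor>"

lemma steps_0 [simp]: "steps 0 h = 0"
  by (simp add: steps_def)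

lemma steps_bounds:
  assumes "0 < h" "0 \<le> t"
  shows "real (steps t h) * h \<le> t" "t < real (steps t h) * h + h"
proof -
  have "real (steps t h) = of_int \<lfloor>t / h\<rfloor>" using assms by (simp add: steps_def)
  then have "real (steps t h) \<le> t / h" "t / h < real (steps t h) + 1" by linarith+
  then show "real (steps t h) * h \<le> t" "t < real (steps t h) * h + h"
    using assms by (auto simp: field_simps)
qed

lemma steps_mono: "0 < h \<Longrightarrow> s \<le> t \<Longrightarrow> steps s h \<le> steps t h"
  unfolding steps_def by (intro nat_mono floor_mono divide_right_mono) auto

text \<open>The extra step is the carry from adding the two fractional parts.\<close>

lemma steps_add:
  assumes "0 < h" "0 \<le> s" "0 \<le> t"
  shows "steps s h + steps t h \<le> steps (s + t) h" "steps (s + t) h \<le> steps s h + steps t h + 1"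
proof -
  have st: "0 \<le> s / h" "0 \<le> t / h" using assms by auto
  have eq: "steps (s + t) h = nat \<lfloor>s / h + t / h\<rfloor>" by (simp add: steps_def add_divide_distrib)
  show "steps s h + steps t h \<le> steps (s + t) h" "steps (s + t) h \<le> steps s h + steps t h + 1"
    unfolding eq unfolding steps_def using st by linarith+
qed

section \<open>Derivatives with values in a closed subspace\<close>

lemma has_vector_derivative_approx:
  assumes "(f has_vector_derivative y) (at s within A)" "0 < e"
  obtains d where "0 < d"
    "\<And>p. p \<in> A \<Longrightarrow> \<bar>p - s\<bar> < d \<Longrightarrow> norm (f p - f s - (p - s) *\<^sub>R y) \<le> e * \<bar>p - s\<bar>"
  using assms unfolding has_vector_derivative_def has_derivative_within_alt real_norm_def by blast

lemma bounded_linear_funpow: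
  fixes T :: "'a::real_normed_vector \<Rightarrow> 'a"
  shows "bounded_linear T \<Longrightarrow> bounded_linear (T ^^ m)"
proof (induction m)
  case 0
  then show ?case by (simp add: id_def bounded_linear_ident)
next
  case (Suc m)
  then show ?case
    using bounded_linear_compose[of T "T ^^ m"] by (simp add: o_def)
qed

text \<open>This replaces integration of the derivative. Differentiability at \<open>s\<close>
  approximates increments over short intervals around \<open>s\<close> by elements of
  \<open>V\<close>, with error at most \<open>e\<close> times the length. Such errors add up under
  concatenation, so bisection gives the same for \<open>{a..b}\<close>; then \<open>e\<close> tends
  to \<open>0\<close> and \<open>V\<close> is closed.\<close>

lemma increment_in_closed_subspace:
  fixes f :: "real \<Rightarrow> 'a::real_normed_vector"
  assumes V: "subspace V" "closed V" and ab: "a \<le> b"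
    and deriv: "\<And>s. s \<in> {a..b} \<Longrightarrow> \<exists>v\<in>V. (f has_vector_derivative v) (at s within {a..b})"
  shows "f b - f a \<in> V"
proof -
  have main: "\<exists>v\<in>V. norm (f b - f a - v) \<le> e * (b - a)" if e: "0 < e" for e
  proof -
    \<comment> \<open>The two guards restrict the claim to subintervals of \<open>{a..b}\<close>,
      since the local condition of \<open>Bolzano\<close> ranges also over intervals that stick
      out.\<close>
    define Q where "Q p q \<longleftrightarrow> a \<le> p \<longrightarrow> q \<le> b \<longrightarrow> (\<exists>v\<in>V. norm (f q - f p - v) \<le> e * (q - p))" for p q
    have "Q a b"
      using ab
    proof (rule Bolzano)
      fix p q r assume *: "Q p q" "Q q r" "p \<le> q" "q \<le> r"
      show "Q p r"
        unfolding Q_def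
      proof (intro impI)
        assume "a \<le> p" "r \<le> b"
        then obtain v w where v: "v \<in> V" "norm (f q - f p - v) \<le> e * (q - p)"
          and w: "w \<in> V" "norm (f r - f q - w) \<le> e * (r - q)"
          using * by (auto simp: Q_def)
        have "norm (f r - f p - (v + w)) \<le> e * (r - p)"
          using v(2) w(2) norm_triangle_ineq[of "f q - f p - v" "f r - f q - w"]
          by (simp add: algebra_simps)
        then show "\<exists>v\<in>V. norm (f r - f p - v) \<le> e * (r - p)"
          using subspace_add[OF V(1) v(1) w(1)] by blast
      qed
    next
      fix s assume s: "a \<le> s" "s \<le> b"
      then obtain y where y: "y \<in> V" "(f has_vector_derivative y) (at s within {a..b})"
        using deriv by auto
      from has_vector_derivative_approx[OF y(2) e] obtain d where d: "0 < d"
        and D: "\<And>p. p \<in> {a..b} \<Longrightarrow> \<bar>p - s\<bar> < d \<Longrightarrow> norm (f p - f s - (p - s) *\<^sub>R y) \<le> e * \<bar>p - s\<bar>"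
        by blast
      have "Q p q" if pq: "p \<le> s" "s \<le> q" "q - p < d" for p q
        unfolding Q_def
      proof (intro impI bexI)
        assume pq': "a \<le> p" "q \<le> b"
        have "norm (f p - f s - (p - s) *\<^sub>R y) \<le> e * (s - p)"
          "norm (f q - f s - (q - s) *\<^sub>R y) \<le> e * (q - s)"
          using D[of p] D[of q] pq pq' by auto
        then show "norm (f q - f p - (q - p) *\<^sub>R y) \<le> e * (q - p)"
          using norm_triangle_ineq4[of "f q - f s - (q - s) *\<^sub>R y" "f p - f s - (p - s) *\<^sub>R y"]
          by (simp add: algebra_simps)
        show "(q - p) *\<^sub>R y \<in> V" using V(1) y(1) by (rule subspace_scale)
      qed
      then show "\<exists>d>0. \<forall>p q. p \<le> s \<and> s \<le> q \<and> q - p < d \<longrightarrow> Q p q"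
        using d by blast
    qed
    then show ?thesis by (simp add: Q_def)
  qed
  have "f b - f a \<in> closure V"
    unfolding closure_approachable
  proof (intro allI impI)
    fix e :: real assume e: "0 < e"
    \<comment> \<open>The summand \<open>1\<close> gives a strict bound and covers
      \<open>a = b\<close>.\<close>
    have *: "0 < e / (b - a + 1)" using e ab by simp
    obtain v where v: "v \<in> V" "norm (f b - f a - v) \<le> e / (b - a + 1) * (b - a)"
      using main[OF *] by blast
    have "e / (b - a + 1) * (b - a) < e" using e ab by (simp add: field_simps)
    then show "\<exists>v\<in>V. dist v (f b - f a) < e"
      using v by (metis dist_commute dist_norm le_less_trans)
  qed
  then show ?thesis using V(2) by (simp add: closure_closed)
qed

section \<open>Uniform estimates for the powers of \<open>F h\<close>\<close>

locale chernoff_function =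
  fixes F :: "real \<Rightarrow> 'x::banach \<Rightarrow> 'x" and M c :: real
  assumes bounded_linear_F: "0 \<le> h \<Longrightarrow> bounded_linear (F h)"
    and F_0: "F 0 = id"
    and M_ge_1: "1 \<le> M"
    and c_nonneg: "0 \<le> c"
    and norm_power: "0 \<le> h \<Longrightarrow> norm ((F h ^^ m) x) \<le> M * exp (c * (real m * h)) * norm x"
    and dense: "closure (Domain (strong_deriv0 F)) = UNIV"
begin

lemma bounded_linear_power: "0 \<le> h \<Longrightarrow> bounded_linear (F h ^^ m)"
  by (intro bounded_linear_funpow bounded_linear_F)

lemmas power_diff = bounded_linear.linear[OF bounded_linear_power, THEN linear_diff]
lemmas power_zero = bounded_linear.linear[OF bounded_linear_power, THEN linear_0]
lemmas power_add = bounded_linear.linear[OF bounded_linear_power, THEN linear_add]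
lemmas power_scaleR = bounded_linear.linear[OF bounded_linear_power, THEN linear_scale]

text \<open>Because \<open>c\<close> is nonnegative, this one constant bounds every power of every
  \<open>F h\<close> up to elapsed time \<open>T\<close>, independently of \<open>h\<close>.\<close>

definition bnd :: "real \<Rightarrow> real" where "bnd T = M * exp (c * T)"

lemma bnd_pos: "0 < bnd T"
  using M_ge_1 by (simp add: bnd_def)

lemma norm_power_le:
  assumes "0 \<le> h" "real m * h \<le> T"
  shows "norm ((F h ^^ m) x) \<le> bnd T * norm x"
proof -
  have "M * exp (c * (real m * h)) \<le> bnd T"
    using assms M_ge_1 c_nonneg by (simp add: bnd_def mult_left_mono)
  then show ?thesis
    using norm_power[OF assms(1), of m x] by (meson mult_right_mono norm_ge_zero order_trans)
qed

lemma power_minus_id: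
  assumes "0 \<le> h"
  shows "(F h ^^ m) v - v = (\<Sum>j<m. (F h ^^ j) (F h v - v))"
proof (induction m)
  case (Suc m)
  have "(F h ^^ Suc m) v - v = (F h ^^ m) (F h v - v) + ((F h ^^ m) v - v)"
    by (simp add: power_diff[OF assms] funpow_Suc_right del: funpow.simps)
  then show ?case using Suc by simp
qed simp

text \<open>Equicontinuity at time \<open>0\<close>, uniform in the step length. For
  \<open>v\<close> in the domain of the derivative, telescoping bounds the displacement by
  \<open>K\<close> times \<open>j\<close> times \<open>norm (F h v - v)\<close>, which is of order
  \<open>j * h\<close>; density and the uniform bound of the powers carry this over to
  \<open>y\<close>.\<close>

lemma power_near_id:
  assumes "0 < e"
  obtains d where "0 < d"
    "\<forall>\<^sub>F h in at_right 0. \<forall>j. real j * h \<le> d \<longrightarrow> norm ((F h ^^ j) y - y) \<le> e"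
proof -
  define K where "K = bnd 1"
  have K: "0 < K" by (simp add: K_def bnd_pos)
  have "y \<in> closure (Domain (strong_deriv0 F))" by (simp add: dense)
  moreover have "0 < e / (2 * (K + 1))" using K assms by simp
  ultimately obtain v w where vw: "(v, w) \<in> strong_deriv0 F" and v: "dist v y < e / (2 * (K + 1))"
    unfolding closure_approachable by (meson DomainE)
  \<comment> \<open>The cap \<open>1\<close> makes \<open>K = bnd 1\<close> applicable; the other
    bound makes the telescoped sum for \<open>v\<close> at most \<open>e / 2\<close>. The distance
    from \<open>v\<close> to \<open>y\<close> uses up the other half.\<close>
  define d where "d = min 1 (e / (2 * K * (norm w + 1)))"
  have nw: "0 < norm w + 1" by (simp add: add_nonneg_pos)
  have d: "0 < d" using K assms nw by (simp add: d_def)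
  have cancel: "e / (2 * K * b) * (K * b) = e / 2" if "0 < b" for b
    using that K by simp
  have "((\<lambda>h. norm ((F h v - v) /\<^sub>R h)) \<longlongrightarrow> norm w) (at_right 0)"
    using vw by (intro tendsto_norm) (simp add: strong_deriv0_def F_0)
  then have "\<forall>\<^sub>F h in at_right 0. norm ((F h v - v) /\<^sub>R h) < norm w + 1"
    by (rule order_tendstoD) simp
  then have "\<forall>\<^sub>F h in at_right 0. \<forall>j. real j * h \<le> d \<longrightarrow> norm ((F h ^^ j) y - y) \<le> e"
    using eventually_at_right_less[of 0]
  proof (eventually_elim, intro allI impI)
    case (elim h)
    fix j assume j: "real j * h \<le> d"
    have h: "0 < h" "0 \<le> h" using elim by auto
    have "norm (F h v - v) / h \<le> norm w + 1"
      using elim(1) h by (simp add: divide_inverse mult.commute)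
    then have Fv: "norm (F h v - v) \<le> h * (norm w + 1)"
      using h by (simp add: pos_divide_le_eq mult.commute)
    have K': "norm ((F h ^^ i) z) \<le> K * norm z" if "i \<le> j" for i z
    proof -
      have "real i * h \<le> real j * h" using that h by (simp add: mult_right_mono)
      then have "real i * h \<le> 1" using j by (simp add: d_def)
      then show ?thesis unfolding K_def using h by (intro norm_power_le)
    qed
    have "norm ((F h ^^ j) v - v) \<le> (\<Sum>i<j. K * (h * (norm w + 1)))"
      unfolding power_minus_id[OF h(2)]
    proof (rule sum_norm_le)
      fix i assume "i \<in> {..<j}"
      then have "norm ((F h ^^ i) (F h v - v)) \<le> K * norm (F h v - v)" by (intro K') simp
      also have "\<dots> \<le> K * (h * (norm w + 1))" using Fv K by (intro mult_left_mono) auto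
      finally show "norm ((F h ^^ i) (F h v - v)) \<le> K * (h * (norm w + 1))" .
    qed
    also have "\<dots> = (real j * h) * (K * (norm w + 1))" by (simp add: algebra_simps)
    also have "\<dots> \<le> e / (2 * K * (norm w + 1)) * (K * (norm w + 1))"
      using j K nw by (intro mult_right_mono) (auto simp: d_def)
    also have "\<dots> = e / 2" by (rule cancel[OF nw])
    finally have 1: "norm ((F h ^^ j) v - v) \<le> e / 2" .
    have "norm ((F h ^^ j) (y - v) - (y - v)) \<le> K * norm (y - v) + norm (y - v)"
      using norm_triangle_ineq4[of "(F h ^^ j) (y - v)" "y - v"] K'[of j "y - v"] by simp
    also have "\<dots> = (K + 1) * dist v y" by (simp add: algebra_simps dist_norm norm_minus_commute)
    also have "\<dots> \<le> (K + 1) * (e / (2 * (K + 1)))" using v K by (intro mult_left_mono) auto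
    also have "\<dots> = e / 2" using K by (simp add: field_simps)
    finally have 2: "norm ((F h ^^ j) (y - v) - (y - v)) \<le> e / 2" .
    have eq: "(F h ^^ j) y - y = ((F h ^^ j) (y - v) - (y - v)) + ((F h ^^ j) v - v)"
      by (simp add: power_diff[OF h(2)])
    show "norm ((F h ^^ j) y - y) \<le> e"
      unfolding eq using norm_triangle_ineq[of "(F h ^^ j) (y - v) - (y - v)" "(F h ^^ j) v - v"] 1 2 by linarith
  qed
  with d show ?thesis by (rule that)
qed

text \<open>Each of the \<open>m\<close> telescoped terms is close to \<open>h *\<^sub>R y\<close>,
  because the difference quotient is close to \<open>y\<close> and small powers move
  \<open>y\<close> little. The tolerance \<open>h\<close> for \<open>m * h\<close> admits
  \<open>steps r h\<close> as well as a difference of two step counts for times \<open>r\<close>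
  apart.\<close>

lemma power_first_order:
  assumes xy: "(x, y) \<in> closure (strong_deriv0 F)" and e: "0 < e"
  obtains d where "0 < d"
    "\<And>r. 0 < r \<Longrightarrow> r < d \<Longrightarrow>
       \<forall>\<^sub>F h in at_right 0. \<forall>m. \<bar>real m * h - r\<bar> \<le> h \<longrightarrow>
         norm ((F h ^^ m) x - x - r *\<^sub>R y) \<le> e * r"
proof -
  define K where "K = bnd 1"
  have K: "0 < K" by (simp add: K_def bnd_pos)
  obtain d0 where d0: "0 < d0"
    and near: "\<forall>\<^sub>F h in at_right 0. \<forall>j. real j * h \<le> d0 \<longrightarrow> norm ((F h ^^ j) y - y) \<le> e / 8"
    using power_near_id[of "e / 8" y] e by auto
  \<comment> \<open>Halved because, for \<open>h < r\<close>, rounding lets \<open>m * h\<close>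
    grow up to \<open>2 * r\<close>.\<close>
  define d where "d = min d0 1 / 2"
  have cancel: "a / (4 * b) * b = a / 4" if "0 < b" for a b :: real
    using that by simp
  have "\<forall>\<^sub>F h in at_right 0. \<forall>m. \<bar>real m * h - r\<bar> \<le> h \<longrightarrow>
         norm ((F h ^^ m) x - x - r *\<^sub>R y) \<le> e * r" if r: "0 < r" "r < d" for r
  proof -
    \<comment> \<open>The first bound makes \<open>T1\<close> small relative to \<open>r\<close>;
      the second, added to an equal error of the difference quotient, gives the
      \<open>e / (8 * K)\<close> in \<open>A\<close>. The approximating pair \<open>(v, w)\<close>
      may depend on \<open>r\<close>, whereas \<open>d\<close> must not.\<close>
    define \<delta> where "\<delta> = min (e * r / (4 * (K + 1))) (e / (16 * K))"
    have "0 < \<delta>" using K e r by (simp add: \<delta>_def)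
    then obtain v w where vw: "(v, w) \<in> strong_deriv0 F" and close: "dist (v, w) (x, y) < \<delta>"
      using xy unfolding closure_approachable by (metis surj_pair)
    have v: "norm (x - v) \<le> e * r / (4 * (K + 1))"
      using close dist_fst_le[of "(v, w)" "(x, y)"]
      by (simp add: \<delta>_def dist_norm norm_minus_commute)
    have w: "norm (w - y) \<le> e / (16 * K)"
      using close dist_snd_le[of "(v, w)" "(x, y)"] by (simp add: \<delta>_def dist_norm)
    have "((\<lambda>h. (F h v - v) /\<^sub>R h) \<longlongrightarrow> w) (at_right 0)"
      using vw by (simp add: strong_deriv0_def F_0)
    then have "\<forall>\<^sub>F h in at_right 0. dist ((F h v - v) /\<^sub>R h) w < e / (16 * K)"
      by (rule tendstoD) (use K e in simp)
    moreover have "\<forall>\<^sub>F h in at_right (0::real). h < min r (e * r / (4 * (norm y + 1)))"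
      using r e by (intro order_tendstoD(2)[OF tendsto_ident_at]) (simp add: add_nonneg_pos)
    ultimately show ?thesis using near eventually_at_right_less[of 0]
    proof (eventually_elim, intro allI impI)
      case (elim h)
      fix m assume m: "\<bar>real m * h - r\<bar> \<le> h"
      have h: "0 < h" "0 \<le> h" using elim by auto
      have mh: "real m * h \<le> 2 * r" using m elim(2) by linarith
      have jh: "real j * h \<le> min d0 1" if "j \<le> m" for j
      proof -
        have "real j * h \<le> real m * h" using that h by (simp add: mult_right_mono)
        then show ?thesis using mh r by (simp add: d_def)
      qed
      have K': "norm ((F h ^^ j) z) \<le> K * norm z" if "j \<le> m" for j z
        unfolding K_def using jh[OF that] by (intro norm_power_le) (use h in auto)
      have A: "norm ((F h v - v) /\<^sub>R h - y) \<le> e / (8 * K)"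
        using elim(1) w norm_triangle_ineq[of "(F h v - v) /\<^sub>R h - w" "w - y"]
        by (simp add: dist_norm)
      \<comment> \<open>Four error sources, each at most \<open>e * r / 4\<close>: replacing
        \<open>x\<close> by \<open>v\<close>, the difference quotient against \<open>y\<close>, the
        drift of \<open>y\<close> under the powers, and the rounding of \<open>r\<close> to
        \<open>m * h\<close>.\<close>
      define T1 where "T1 = (F h ^^ m) (x - v) - (x - v)"
      define T2 where "T2 = (\<Sum>j<m. h *\<^sub>R (F h ^^ j) ((F h v - v) /\<^sub>R h - y))"
      define T3 where "T3 = (\<Sum>j<m. h *\<^sub>R ((F h ^^ j) y - y))"
      define T4 where "T4 = (real m * h - r) *\<^sub>R y"
      have "T2 + T3 = (\<Sum>j<m. (F h ^^ j) (F h v - v) - h *\<^sub>R y)"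
        unfolding T2_def T3_def sum.distrib[symmetric]
        using h by (intro sum.cong) (simp_all add: power_diff[OF h(2)] power_scaleR[OF h(2)] scaleR_right_diff_distrib)
      also have "\<dots> = (F h ^^ m) v - v - (real m * h) *\<^sub>R y"
        by (simp add: sum_subtractf power_minus_id[OF h(2)] flip: scaleR_conv_of_real)
           (simp add: sum_constant_scaleR)
      finally have eq: "(F h ^^ m) x - x - r *\<^sub>R y = T1 + (T2 + T3) + T4"
        by (simp add: T1_def T4_def power_diff[OF h(2)] algebra_simps)
      have "norm T1 \<le> K * norm (x - v) + norm (x - v)"
        unfolding T1_def
        using norm_triangle_ineq4[of "(F h ^^ m) (x - v)" "x - v"] K'[of m "x - v"] by simp
      also have "\<dots> = (K + 1) * norm (x - v)" by (simp add: algebra_simps)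
      also have "\<dots> \<le> (K + 1) * (e * r / (4 * (K + 1)))"
        using v K by (intro mult_left_mono) auto
      also have "\<dots> = e * r / 4" using K by (simp add: field_simps)
      finally have T1: "norm T1 \<le> e * r / 4" .
      have "norm T2 \<le> (\<Sum>j<m. h * (e / 8))"
        unfolding T2_def
      proof (rule sum_norm_le)
        fix j assume "j \<in> {..<m}"
        then have "norm ((F h ^^ j) ((F h v - v) /\<^sub>R h - y)) \<le> K * (e / (8 * K))"
          using K'[of j "(F h v - v) /\<^sub>R h - y"] mult_left_mono[OF A, of K] K by fastforce
        then show "norm (h *\<^sub>R (F h ^^ j) ((F h v - v) /\<^sub>R h - y)) \<le> h * (e / 8)"
          using K h by simp
      qed
      also have "\<dots> = (real m * h) * (e / 8)" by simp
      also have "\<dots> \<le> 2 * r * (e / 8)" using mh e by (intro mult_right_mono) auto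
      finally have T2: "norm T2 \<le> e * r / 4" by simp
      have "norm T3 \<le> (\<Sum>j<m. h * (e / 8))"
        unfolding T3_def
      proof (rule sum_norm_le)
        fix j assume "j \<in> {..<m}"
        then show "norm (h *\<^sub>R ((F h ^^ j) y - y)) \<le> h * (e / 8)"
          using elim(3) jh[of j] h by simp
      qed
      also have "\<dots> = (real m * h) * (e / 8)" by simp
      also have "\<dots> \<le> 2 * r * (e / 8)" using mh e by (intro mult_right_mono) auto
      finally have T3: "norm T3 \<le> e * r / 4" by simp
      have "norm T4 \<le> h * (norm y + 1)"
        using m h unfolding T4_def norm_scaleR by (intro mult_mono) auto
      also have "\<dots> \<le> e * r / (4 * (norm y + 1)) * (norm y + 1)"
        using elim(2) by (intro mult_right_mono) auto
      also have "\<dots> = e * r / 4" by (rule cancel) (simp add: add_nonneg_pos)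
      finally have T4: "norm T4 \<le> e * r / 4" .
      show "norm ((F h ^^ m) x - x - r *\<^sub>R y) \<le> e * r"
        unfolding eq
        using T1 T2 T3 T4 norm_triangle_ineq[of "T1 + (T2 + T3)" T4]
          norm_triangle_ineq[of T1 "T2 + T3"] norm_triangle_ineq[of T2 T3] by linarith
    qed
  qed
  moreover have "0 < d" using d0 by (simp add: d_def)
  ultimately show ?thesis using that by blast
qed

section \<open>Convergence along solutions\<close>

text \<open>Consistency plus stability. Near a time \<open>s\<close>, the solution and the powers of
  \<open>F h\<close> have the same first-order expansion with slope \<open>y\<close>, so their
  discrepancy over a short interval around \<open>s\<close> is small compared with its length. The
  uniform bound transports these local errors to the end, and bisection collects them.\<close>

lemma solution_limit:
  assumes f: "\<And>s. s \<in> {0..<l} \<Longrightarrow>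
      \<exists>y. (f s, y) \<in> closure (strong_deriv0 F) \<and> (f has_vector_derivative y) (at s within {0..<l})"
    and t: "t \<in> {0..<l}"
  shows "((\<lambda>h. (F h ^^ steps t h) (f 0)) \<longlongrightarrow> f t) (at_right 0)"
proof -
  define K where "K = bnd t"
  have K: "0 < K" by (simp add: K_def bnd_pos)
  have main: "\<forall>\<^sub>F h in at_right 0. norm ((F h ^^ steps t h) (f 0) - f t) \<le> e * t" if e: "0 < e" for e
  proof -
    \<comment> \<open>The additional power \<open>j\<close> makes this estimate additive under concatenation of intervals
      although \<open>F h\<close> is only power bounded and not a contraction.\<close>
    define Q where "Q p q \<longleftrightarrow> 0 \<le> p \<longrightarrow> q \<le> t \<longrightarrow>
       (\<forall>\<^sub>F h in at_right 0. \<forall>j. real (j + steps q h) * h \<le> t \<longrightarrow>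
          norm ((F h ^^ j) ((F h ^^ (steps q h - steps p h)) (f p) - f q)) \<le> e * (q - p))" for p q
    have "Q 0 t"
    proof (rule Bolzano)
      show "0 \<le> t" using t by simp
    next
      fix p q r assume *: "Q p q" "Q q r" "p \<le> q" "q \<le> r"
      show "Q p r"
        unfolding Q_def
      proof (intro impI)
        assume pr: "0 \<le> p" "r \<le> t"
        have 1: "\<forall>\<^sub>F h in at_right 0. \<forall>j. real (j + steps q h) * h \<le> t \<longrightarrow>
          norm ((F h ^^ j) ((F h ^^ (steps q h - steps p h)) (f p) - f q)) \<le> e * (q - p)"
          and 2: "\<forall>\<^sub>F h in at_right 0. \<forall>j. real (j + steps r h) * h \<le> t \<longrightarrow>
          norm ((F h ^^ j) ((F h ^^ (steps r h - steps q h)) (f q) - f r)) \<le> e * (r - q)"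
          using * pr by (auto simp: Q_def)
        from 1 2 eventually_at_right_less[of 0]
        show "\<forall>\<^sub>F h in at_right 0. \<forall>j. real (j + steps r h) * h \<le> t \<longrightarrow>
          norm ((F h ^^ j) ((F h ^^ (steps r h - steps p h)) (f p) - f r)) \<le> e * (r - p)"
        proof (eventually_elim, intro allI impI)
          case (elim h)
          fix j assume j: "real (j + steps r h) * h \<le> t"
          have h: "0 \<le> h" using elim by simp
          define m where "m = steps r h - steps q h"
          define n where "n = steps q h - steps p h"
          have mono: "steps p h \<le> steps q h" "steps q h \<le> steps r h"
            using * elim(3) by (auto intro: steps_mono)
          then have mn: "steps r h - steps p h = m + n" "(j + m) + steps q h = j + steps r h"
            by (auto simp: m_def n_def)
          have "(F h ^^ j) ((F h ^^ (steps r h - steps p h)) (f p) - f r)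
              = (F h ^^ (j + m)) ((F h ^^ n) (f p) - f q) + (F h ^^ j) ((F h ^^ m) (f q) - f r)"
            by (simp add: mn funpow_add power_diff[OF h])
          moreover have "norm ((F h ^^ (j + m)) ((F h ^^ n) (f p) - f q)) \<le> e * (q - p)"
            using elim(1) j unfolding n_def by (metis mn(2))
          moreover have "norm ((F h ^^ j) ((F h ^^ m) (f q) - f r)) \<le> e * (r - q)"
            using elim(2) j unfolding m_def by blast
          ultimately show "norm ((F h ^^ j) ((F h ^^ (steps r h - steps p h)) (f p) - f r)) \<le> e * (r - p)"
            using norm_triangle_ineq[of "(F h ^^ (j + m)) ((F h ^^ n) (f p) - f q)"
                "(F h ^^ j) ((F h ^^ m) (f q) - f r)"]
            by (simp add: algebra_simps)
        qed
      qed
    next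
      fix s assume s: "0 \<le> s" "s \<le> t"
      then obtain y where y: "(f s, y) \<in> closure (strong_deriv0 F)"
        and deriv: "(f has_vector_derivative y) (at s within {0..<l})"
        using f[of s] t by auto
      \<comment> \<open>Four local errors with weights \<open>1\<close>, \<open>K\<close>,
        \<open>1\<close>, \<open>1\<close> sum to \<open>K + 3\<close>; the remaining
        \<open>j\<close> steps contribute another factor \<open>K\<close>.\<close>
      define \<eta> where "\<eta> = e / (K * (K + 3))"
      have \<eta>: "0 < \<eta>" using e K by (simp add: \<eta>_def)
      obtain d1 where d1: "0 < d1" and D1: "\<And>p. p \<in> {0..<l} \<Longrightarrow> \<bar>p - s\<bar> < d1 \<Longrightarrow>
          norm (f p - f s - (p - s) *\<^sub>R y) \<le> \<eta> * \<bar>p - s\<bar>"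
        using has_vector_derivative_approx[OF deriv \<eta>] by blast
      obtain d2 where d2: "0 < d2" and D2: "\<And>r. 0 < r \<Longrightarrow> r < d2 \<Longrightarrow>
          \<forall>\<^sub>F h in at_right 0. \<forall>m. \<bar>real m * h - r\<bar> \<le> h \<longrightarrow>
            norm ((F h ^^ m) (f s) - f s - r *\<^sub>R y) \<le> \<eta> * r"
        using power_first_order[OF y \<eta>] by blast
      obtain d3 where d3: "0 < d3" and D3: "\<forall>\<^sub>F h in at_right 0. \<forall>j. real j * h \<le> d3 \<longrightarrow>
          norm ((F h ^^ j) y - y) \<le> \<eta>"
        using power_near_id[OF \<eta>] by blast
      \<comment> \<open>With \<open>h < r\<close> the elapsed time \<open>m * h\<close> is at most
        \<open>2 * r\<close>, which explains \<open>d3 / 2\<close>.\<close>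
      have "Q p q" if pq: "p \<le> s" "s \<le> q" "q - p < min d1 (min d2 (d3 / 2))" for p q
        unfolding Q_def
      proof (intro impI)
        assume pq': "0 \<le> p" "q \<le> t"
        define r where "r = q - p"
        show "\<forall>\<^sub>F h in at_right 0. \<forall>j. real (j + steps q h) * h \<le> t \<longrightarrow>
          norm ((F h ^^ j) ((F h ^^ (steps q h - steps p h)) (f p) - f q)) \<le> e * (q - p)"
        proof (cases "r = 0")
          case True
          show ?thesis
            using eventually_at_right_less[of 0]
            by eventually_elim (use True in \<open>simp add: r_def power_zero\<close>)
        next
          case False
          then have r: "0 < r" "r < d2" "2 * r < d3" using pq by (auto simp: r_def)
          have fp: "norm (f p - f s - (p - s) *\<^sub>R y) \<le> \<eta> * r"
            using D1[of p] pq pq' t s \<eta> by (auto simp: r_def intro: order_trans mult_left_mono)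
          have fq: "norm (f q - f s - (q - s) *\<^sub>R y) \<le> \<eta> * r"
            using D1[of q] pq pq' t s \<eta> by (auto simp: r_def intro: order_trans mult_left_mono)
          have "\<forall>\<^sub>F h in at_right (0::real). h < r"
            using r by (intro order_tendstoD(2)[OF tendsto_ident_at])
          with D2[OF r(1,2)] D3 eventually_at_right_less[of 0] show ?thesis
          proof (eventually_elim, intro allI impI)
            case (elim h)
            fix j assume j: "real (j + steps q h) * h \<le> t"
            have h: "0 < h" "0 \<le> h" using elim by auto
            define m where "m = steps q h - steps p h"
            have "steps p h \<le> steps q h" using pq h by (auto intro: steps_mono)
            then have "real m * h = real (steps q h) * h - real (steps p h) * h"
              by (simp add: m_def of_nat_diff left_diff_distrib)
            then have mr: "\<bar>real m * h - r\<bar> \<le> h"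
              using steps_bounds[OF h(1), of p] steps_bounds[OF h(1), of q] pq pq'
              by (auto simp: r_def)
            have mt: "real m * h \<le> real (steps q h) * h"
              using h by (intro mult_right_mono) (auto simp: m_def)
            also have "\<dots> \<le> t" using steps_bounds[OF h(1), of q] pq pq' by auto
            finally have mt: "real m * h \<le> t" .
            have "real m * h \<le> d3" using mr elim(4) r(3) by linarith
            then have A3: "norm ((F h ^^ m) y - y) \<le> \<eta>" using elim(2) by blast
            have A1: "norm ((F h ^^ m) (f s) - f s - r *\<^sub>R y) \<le> \<eta> * r" using elim(1) mr by blast
            define u where "u = f p - f s - (p - s) *\<^sub>R y"
            have "norm ((F h ^^ m) u) \<le> K * norm u"
              unfolding K_def using h mt by (intro norm_power_le) auto
            also have "\<dots> \<le> K * (\<eta> * r)" using fp K by (simp add: u_def)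
            finally have A2: "norm ((F h ^^ m) u) \<le> K * (\<eta> * r)" .
            have A4: "norm ((p - s) *\<^sub>R ((F h ^^ m) y - y)) \<le> \<eta> * r"
              using pq A3 mult_mono[of "\<bar>p - s\<bar>" r "norm ((F h ^^ m) y - y)" \<eta>] r
              by (auto simp: r_def mult.commute)
            \<comment> \<open>Both endpoints are expanded at \<open>s\<close>. The terms are the
              expansion of the power at \<open>f s\<close>, the transported remainder of
              \<open>f\<close> at \<open>p\<close>, the change of the slope \<open>y\<close> under
              the power, and the remainder of \<open>f\<close> at \<open>q\<close>.\<close>
            have eq: "(F h ^^ m) (f p) - f q = ((F h ^^ m) (f s) - f s - r *\<^sub>R y) + (F h ^^ m) u
                + (p - s) *\<^sub>R ((F h ^^ m) y - y) - (f q - f s - (q - s) *\<^sub>R y)"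
              by (simp add: u_def r_def power_diff[OF h(2)] power_scaleR[OF h(2)] scaleR_diff_left scaleR_diff_right)
            have B: "norm ((F h ^^ m) (f p) - f q) \<le> \<eta> * r + K * (\<eta> * r) + \<eta> * r + \<eta> * r"
              unfolding eq using A1 A2 A4 fq
                norm_triangle_ineq4[of "((F h ^^ m) (f s) - f s - r *\<^sub>R y) + (F h ^^ m) u
                  + (p - s) *\<^sub>R ((F h ^^ m) y - y)" "f q - f s - (q - s) *\<^sub>R y"]
                norm_triangle_ineq[of "((F h ^^ m) (f s) - f s - r *\<^sub>R y) + (F h ^^ m) u"
                  "(p - s) *\<^sub>R ((F h ^^ m) y - y)"]
                norm_triangle_ineq[of "(F h ^^ m) (f s) - f s - r *\<^sub>R y" "(F h ^^ m) u"]
              by linarith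
            have "real j * h \<le> t"
              using j mult_nonneg_nonneg[OF of_nat_0_le_iff h(2), of "steps q h"]
              unfolding of_nat_add distrib_right by linarith
            then have "norm ((F h ^^ j) ((F h ^^ m) (f p) - f q)) \<le> K * norm ((F h ^^ m) (f p) - f q)"
              unfolding K_def using h by (intro norm_power_le) auto
            also have "\<dots> \<le> K * (\<eta> * r + K * (\<eta> * r) + \<eta> * r + \<eta> * r)"
              using B K by simp
            also have "\<dots> = \<eta> * (K * (K + 3)) * r" by (simp add: algebra_simps)
            also have "\<dots> = e * r" using K by (simp add: \<eta>_def)
            finally show "norm ((F h ^^ j) ((F h ^^ (steps q h - steps p h)) (f p) - f q)) \<le> e * (q - p)"
              by (simp add: m_def r_def)
          qed
        qed
      qed
      then show "\<exists>d>0. \<forall>p q. p \<le> s \<and> s \<le> q \<and> q - p < d \<longrightarrow> Q p q"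
        using d1 d2 d3 by (intro exI[of _ "min d1 (min d2 (d3 / 2))"]) auto
    qed
    then have "\<forall>\<^sub>F h in at_right 0. \<forall>j. real (j + steps t h) * h \<le> t \<longrightarrow>
          norm ((F h ^^ j) ((F h ^^ (steps t h - steps 0 h)) (f 0) - f t)) \<le> e * (t - 0)"
      by (simp add: Q_def)
    with eventually_at_right_less[of 0] show ?thesis
    proof eventually_elim
      case (elim h)
      then show ?case
        using steps_bounds[of h t] t by (auto dest: spec[of _ 0])
    qed
  qed
  show ?thesis
  proof (rule tendstoI)
    fix e :: real assume e: "0 < e"
    have "e / (t + 1) * t < e" using t e by (simp add: field_simps)
    moreover have "0 < e / (t + 1)" using t e by simp
    ultimately show "\<forall>\<^sub>F h in at_right 0. dist ((F h ^^ steps t h) (f 0)) (f t) < e"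
      using main[of "e / (t + 1)"] by (auto elim!: eventually_mono simp: dist_norm)
  qed
qed

section \<open>From dense initial values and short times to everything\<close>

text \<open>Up to time \<open>T\<close> the powers share the Lipschitz constant
  \<open>bnd T\<close>, so a convergent argument may be replaced by its limit. This permits
  multiplying limits of powers.\<close>

lemma tendsto_power:
  assumes u: "(u \<longlongrightarrow> u0) (at_right 0)"
    and w: "((\<lambda>h. (F h ^^ m h) u0) \<longlongrightarrow> w) (at_right 0)"
    and T: "\<forall>\<^sub>F h in at_right 0. real (m h) * h \<le> T"
  shows "((\<lambda>h. (F h ^^ m h) (u h)) \<longlongrightarrow> w) (at_right 0)"
proof (rule Lim_transform[OF w], rule Lim_null_comparison)
  show "\<forall>\<^sub>F h in at_right 0. norm ((F h ^^ m h) (u h) - (F h ^^ m h) u0) \<le> bnd T * norm (u h - u0)"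
    using T eventually_at_right_less[of 0]
  proof eventually_elim
    case (elim h)
    then show ?case
      using norm_power_le[of h "m h" T "u h - u0"] by (simp add: power_diff)
  qed
  have "((\<lambda>h. bnd T * norm (u h - u0)) \<longlongrightarrow> bnd T * norm (u0 - u0)) (at_right 0)"
    by (intro tendsto_intros u)
  then show "((\<lambda>h. bnd T * norm (u h - u0)) \<longlongrightarrow> 0) (at_right 0)" by simp
qed

text \<open>At most \<open>k\<close> steps take the vanishing time \<open>k * h\<close>, so
  \<open>power_near_id\<close> applies. This later absorbs the carry in
  \<open>steps_add\<close>.\<close>

lemma tendsto_power_bounded_exponent:
  assumes m: "\<forall>\<^sub>F h in at_right 0. m h \<le> k"
  shows "((\<lambda>h. (F h ^^ m h) z) \<longlongrightarrow> z) (at_right 0)"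
proof (rule tendstoI)
  fix e :: real assume e: "0 < e"
  obtain d where d: "0 < d"
    and D: "\<forall>\<^sub>F h in at_right 0. \<forall>j. real j * h \<le> d \<longrightarrow> norm ((F h ^^ j) z - z) \<le> e / 2"
    using power_near_id[of "e / 2" z] e by auto
  have "\<forall>\<^sub>F h in at_right (0::real). h < d / (real k + 1)"
    using d by (intro order_tendstoD(2)[OF tendsto_ident_at]) simp
  with D m eventually_at_right_less[of 0]
  show "\<forall>\<^sub>F h in at_right 0. dist ((F h ^^ m h) z) z < e"
  proof eventually_elim
    case (elim h)
    have "real (m h) * h \<le> (real k + 1) * h" using elim by (intro mult_right_mono) auto
    also have "\<dots> \<le> d" using elim(4) by (simp add: field_simps)
    finally show ?case using elim(1) e by (fastforce simp: dist_norm)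
  qed
qed

definition convergent_at :: "real \<Rightarrow> bool" where
  "convergent_at t \<longleftrightarrow> (\<forall>x. \<exists>y. ((\<lambda>h. (F h ^^ steps t h) x) \<longlongrightarrow> y) (at_right 0))"

definition S :: "real \<Rightarrow> 'x \<Rightarrow> 'x" where
  "S t x = Lim (at_right 0) (\<lambda>h. (F h ^^ steps t h) x)"

lemma tendsto_S: "convergent_at t \<Longrightarrow> ((\<lambda>h. (F h ^^ steps t h) x) \<longlongrightarrow> S t x) (at_right 0)"
  unfolding convergent_at_def S_def by (metis tendsto_Lim trivial_limit_at_right_real)

lemma S_eqI: "((\<lambda>h. (F h ^^ steps t h) x) \<longlongrightarrow> y) (at_right 0) \<Longrightarrow> S t x = y"
  unfolding S_def by (rule tendsto_Lim) auto

lemma eventually_steps_le: "0 \<le> t \<Longrightarrow> t \<le> T \<Longrightarrow> \<forall>\<^sub>F h in at_right 0. real (steps t h) * h \<le> T"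
  using eventually_at_right_less[of 0] by eventually_elim (use steps_bounds[of _ t] in fastforce)

text \<open>Approximating \<open>x\<close> by \<open>v\<close> in \<open>A\<close> places the powers
  at \<open>x\<close> eventually within \<open>e / 2\<close> of the limit \<open>y\<close> for
  \<open>v\<close>. Since \<open>y\<close> varies with \<open>e\<close>, this yields the Cauchy
  property only, and completeness supplies the limit.\<close>

lemma convergent_at_dense:
  assumes t: "0 \<le> t" and A: "closure A = UNIV"
    and conv: "\<And>x. x \<in> A \<Longrightarrow> \<exists>y. ((\<lambda>h. (F h ^^ steps t h) x) \<longlongrightarrow> y) (at_right 0)"
  shows "convergent_at t"
  unfolding convergent_at_def
proof
  fix x
  define g where "g h = (F h ^^ steps t h) x" for h
  define K where "K = bnd t"
  have K: "0 < K" by (simp add: K_def bnd_pos)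
  have "cauchy_filter (filtermap g (at_right 0))"
    unfolding cauchy_filter_metric_filtermap
  proof (intro allI impI)
    fix e :: real assume e: "0 < e"
    have "x \<in> closure A" by (simp add: A)
    moreover have "0 < e / (4 * K)" using K e by simp
    ultimately obtain v where v: "v \<in> A" and xv: "dist v x < e / (4 * K)"
      unfolding closure_approachable by blast
    obtain y where y: "((\<lambda>h. (F h ^^ steps t h) v) \<longlongrightarrow> y) (at_right 0)"
      using conv[OF v] by blast
    have ev: "\<forall>\<^sub>F h in at_right 0. dist ((F h ^^ steps t h) v) y < e / 4"
      using e by (intro tendstoD[OF y]) simp
    have "\<forall>\<^sub>F h in at_right 0. dist (g h) y < e / 2"
      using ev eventually_steps_le[OF t order_refl] eventually_at_right_less[of 0]
    proof eventually_elim
      case (elim h)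
      have h: "0 \<le> h" using elim by simp
      have "norm ((F h ^^ steps t h) (x - v)) \<le> K * norm (x - v)"
        unfolding K_def using elim by (intro norm_power_le) auto
      also have "\<dots> \<le> K * (e / (4 * K))"
        using xv K by (intro mult_left_mono) (auto simp: dist_norm norm_minus_commute)
      also have "\<dots> = e / 4" using K by simp
      finally have "dist (g h) ((F h ^^ steps t h) v) \<le> e / 4"
        by (simp add: dist_norm g_def power_diff[OF h])
      then show ?case
        using elim(1) dist_triangle[of "g h" y "(F h ^^ steps t h) v"] by simp
    qed
    then show "\<exists>P. eventually P (at_right 0) \<and> (\<forall>h k. P h \<and> P k \<longrightarrow> dist (g h) (g k) < e)"
      by (intro exI[of _ "\<lambda>h. dist (g h) y < e / 2"]) (auto intro: dist_triangle_half_l)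
  qed
  then show "\<exists>y. (g \<longlongrightarrow> y) (at_right 0)"
    using complete_UNIV[where 'a = 'x] unfolding complete_uniform filterlim_def
    by (simp add: filtermap_bot_iff)
qed

text \<open>The count for \<open>s + t\<close> exceeds the sum of the two counts by
  \<open>m h\<close>, which is \<open>0\<close> or \<open>1\<close>. The product of the powers
  converges by \<open>tendsto_power\<close>, and the possible additional step tends to the
  identity.\<close>

lemma tendsto_steps_add:
  assumes s: "0 \<le> s" "convergent_at s" and t: "0 \<le> t" "convergent_at t"
  shows "((\<lambda>h. (F h ^^ steps (s + t) h) x) \<longlongrightarrow> S s (S t x)) (at_right 0)"
proof -
  define m where "m h = steps (s + t) h - steps s h - steps t h" for h
  have m: "\<forall>\<^sub>F h in at_right 0. m h \<le> 1 \<and> steps (s + t) h = m h + (steps s h + steps t h)"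
    using eventually_at_right_less[of 0]
    proof eventually_elim
      case (elim h)
      then show ?case using steps_add[of h s t] s t by (simp add: m_def)
    qed
  have 1: "((\<lambda>h. (F h ^^ steps s h) ((F h ^^ steps t h) x)) \<longlongrightarrow> S s (S t x)) (at_right 0)"
    using tendsto_power[OF tendsto_S[OF t(2)] tendsto_S[OF s(2)] eventually_steps_le[OF s(1) order_refl]] .
  have m1: "\<forall>\<^sub>F h in at_right 0. m h \<le> 1"
    using m by eventually_elim auto
  have "\<forall>\<^sub>F h in at_right (0::real). h < 1"
    by (intro order_tendstoD(2)[OF tendsto_ident_at]) simp
  with m1 eventually_at_right_less[of 0]
  have "\<forall>\<^sub>F h in at_right 0. real (m h) * h \<le> 1"
    by eventually_elim (auto intro!: mult_le_one)
  with 1 tendsto_power_bounded_exponent[OF m1]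
  have "((\<lambda>h. (F h ^^ m h) ((F h ^^ steps s h) ((F h ^^ steps t h) x))) \<longlongrightarrow> S s (S t x)) (at_right 0)"
    by (rule tendsto_power)
  then show ?thesis
    by (rule Lim_transform_eventually) (use m in \<open>eventually_elim, simp add: funpow_add\<close>)
qed

text \<open>The time \<open>t\<close> is a multiple of some \<open>\<tau>\<close> below
  \<open>l\<close>, and convergence passes from \<open>k * \<tau>\<close> to the next multiple by
  \<open>tendsto_steps_add\<close>.\<close>

lemma convergent_at_extend:
  assumes l: "0 < l" and conv: "\<And>t. t \<in> {0..<l} \<Longrightarrow> convergent_at t" and t: "0 \<le> t"
  shows "convergent_at t"
proof -
  obtain n :: nat where n: "t / l < real n" using reals_Archimedean2 by blast
  define \<tau> where "\<tau> = t / real n"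
  have n0: "0 < real n" using n t l by (smt (verit) divide_nonneg_pos)
  have \<tau>: "\<tau> \<in> {0..<l}" using n n0 t l by (simp add: \<tau>_def field_simps)
  have "convergent_at (real k * \<tau>)" for k
  proof (induction k)
    case 0
    then show ?case using conv[of 0] l by simp
  next
    case (Suc k)
    then have "((\<lambda>h. (F h ^^ steps (real k * \<tau> + \<tau>) h) x) \<longlongrightarrow> S (real k * \<tau>) (S \<tau> x)) (at_right 0)" for x
      using \<tau> conv[OF \<tau>] by (intro tendsto_steps_add) auto
    then show ?case
      unfolding convergent_at_def by (auto simp: algebra_simps)
  qed
  from this[of n] show ?thesis using n0 by (simp add: \<tau>_def)
qed

end

section \<open>The limit semigroup\<close>

locale convergent_chernoff_function = chernoff_function +
  assumes convergent: "0 \<le> t \<Longrightarrow> convergent_at t"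
begin

lemmas tendsto_S' = tendsto_S[OF convergent]

lemma S_0: "S 0 = id"
  by (auto intro!: S_eqI)

lemma S_add_time: "0 \<le> s \<Longrightarrow> 0 \<le> t \<Longrightarrow> S (s + t) x = S s (S t x)"
  by (intro S_eqI tendsto_steps_add convergent)

lemma norm_S_le:
  assumes "0 \<le> t" "t \<le> T"
  shows "norm (S t x) \<le> bnd T * norm x"
proof (rule tendsto_upperbound[OF tendsto_norm[OF tendsto_S'[OF assms(1)]]])
  show "\<forall>\<^sub>F h in at_right 0. norm ((F h ^^ steps t h) x) \<le> bnd T * norm x"
    using eventually_steps_le[OF assms] eventually_at_right_less[of 0]
    by eventually_elim (intro norm_power_le, auto)
qed simp

text \<open>Used with \<open>g\<close> a multiplication by a real scalar for
  \<open>bounded_linear_S\<close>, and by a scalar of the field in the final theorem.\<close>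

lemma S_commute:
  assumes g: "bounded_linear g" and comm: "\<And>h x. 0 \<le> h \<Longrightarrow> F h (g x) = g (F h x)" and t: "0 \<le> t"
  shows "S t (g x) = g (S t x)"
proof (rule S_eqI, rule Lim_transform_eventually)
  show "((\<lambda>h. g ((F h ^^ steps t h) x)) \<longlongrightarrow> g (S t x)) (at_right 0)"
    by (intro bounded_linear.tendsto[OF g] tendsto_S' t)
  have "(F h ^^ m) (g x) = g ((F h ^^ m) x)" if "0 \<le> h" for h m
    by (induction m) (use comm that in auto)
  then show "\<forall>\<^sub>F h in at_right 0. g ((F h ^^ steps t h) x) = (F h ^^ steps t h) (g x)"
    using eventually_at_right_less[of 0] by (auto elim: eventually_mono)
qed

lemma bounded_linear_S:
  assumes t: "0 \<le> t"
  shows "bounded_linear (S t)"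
proof (rule bounded_linear_intro)
  fix x y
  show "S t (x + y) = S t x + S t y"
  proof (rule S_eqI, rule Lim_transform_eventually)
    show "((\<lambda>h. (F h ^^ steps t h) x + (F h ^^ steps t h) y) \<longlongrightarrow> S t x + S t y) (at_right 0)"
      by (intro tendsto_add tendsto_S' t)
    show "\<forall>\<^sub>F h in at_right 0. (F h ^^ steps t h) x + (F h ^^ steps t h) y = (F h ^^ steps t h) (x + y)"
      using eventually_at_right_less[of 0] by eventually_elim (simp add: power_add)
  qed
next
  show "S t (r *\<^sub>R x) = r *\<^sub>R S t x" for r x
    by (intro S_commute t bounded_linear_scaleR_right)
       (simp add: linear_scale bounded_linear.linear bounded_linear_F)
  show "norm (S t x) \<le> norm x * bnd t" for x
    using norm_S_le[OF t order_refl] by (simp add: mult.commute)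
qed

lemma S_near_id:
  assumes e: "0 < e"
  obtains d where "0 < d" "\<And>r. 0 \<le> r \<Longrightarrow> r \<le> d \<Longrightarrow> norm (S r x - x) \<le> e"
proof -
  obtain d where d: "0 < d"
    and D: "\<forall>\<^sub>F h in at_right 0. \<forall>j. real j * h \<le> d \<longrightarrow> norm ((F h ^^ j) x - x) \<le> e"
    using power_near_id[OF e] by blast
  have "norm (S r x - x) \<le> e" if r: "0 \<le> r" "r \<le> d" for r
  proof (rule tendsto_upperbound)
    show "((\<lambda>h. norm ((F h ^^ steps r h) x - x)) \<longlongrightarrow> norm (S r x - x)) (at_right 0)"
      by (intro tendsto_intros tendsto_S' r)
    show "\<forall>\<^sub>F h in at_right 0. norm ((F h ^^ steps r h) x - x) \<le> e"
      using D eventually_steps_le[OF r] by eventually_elim blast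
  qed simp
  with d show ?thesis by (rule that)
qed

text \<open>Factoring out the earlier of two times reduces continuity from both sides to
  \<open>S_near_id\<close>, with one norm bound near \<open>t\<close>.\<close>

lemma continuous_S: "continuous_on {0..} (\<lambda>t. S t x)"
  unfolding continuous_on_iff
proof (intro ballI allI impI)
  fix t e :: real assume t: "t \<in> {0..}" and e: "0 < e"
  define K where "K = bnd (t + 1)"
  have K: "0 < K" by (simp add: K_def bnd_pos)
  have *: "norm (S q x - S p x) \<le> K * norm (S (q - p) x - x)" if "0 \<le> p" "p \<le> q" "p \<le> t + 1" for p q
  proof -
    have "S q x - S p x = S p (S (q - p) x - x)"
      using S_add_time[of p "q - p" x] that
      by (simp add: linear_diff[OF bounded_linear.linear[OF bounded_linear_S]])
    then show ?thesis unfolding K_def using norm_S_le[of p "t + 1"] that by simp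
  qed
  obtain d where d: "0 < d" and D: "\<And>r. 0 \<le> r \<Longrightarrow> r \<le> d \<Longrightarrow> norm (S r x - x) \<le> e / (2 * K)"
    using S_near_id[of "e / (2 * K)" x] e K by auto
  have bound: "K * norm (S r x - x) < e" if "0 \<le> r" "r \<le> d" for r
    using mult_left_mono[OF D[OF that], of K] K e by simp
  show "\<exists>d>0. \<forall>s\<in>{0..}. dist s t < d \<longrightarrow> dist (S s x) (S t x) < e"
  proof (intro exI[of _ "min d 1"] conjI ballI impI)
    fix s assume s: "s \<in> {0..}" "dist s t < min d 1"
    show "dist (S s x) (S t x) < e"
    proof (cases "s \<le> t")
      case True
      then show ?thesis
        using *[of s t] bound[of "t - s"] s t by (auto simp: dist_norm norm_minus_commute)
    next
      case False
      then show ?thesis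
        using *[of t s] bound[of "s - t"] s t by (auto simp: dist_norm)
    qed
  qed (use d in simp)
qed

section \<open>The generator of the limit semigroup\<close>

text \<open>In \<open>power_first_order\<close> the range of \<open>r\<close> is chosen before
  \<open>h\<close>. For fixed \<open>r\<close> the limit in \<open>h\<close> therefore keeps the
  estimate, which then says that \<open>S\<close> has derivative \<open>y\<close> at
  \<open>x\<close>.\<close>

lemma closure_strong_deriv0_subset: "closure (strong_deriv0 F) \<subseteq> strong_deriv0 S"
proof clarify
  fix x y assume xy: "(x, y) \<in> closure (strong_deriv0 F)"
  have "((\<lambda>r. (S r x - x) /\<^sub>R r) \<longlongrightarrow> y) (at_right 0)"
  proof (rule tendstoI)
    fix e :: real assume "0 < e"
    then have e: "0 < e / 2" by simp
    obtain d where d: "0 < d" and D: "\<And>r. 0 < r \<Longrightarrow> r < d \<Longrightarrow>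
       \<forall>\<^sub>F h in at_right 0. \<forall>m. \<bar>real m * h - r\<bar> \<le> h \<longrightarrow>
         norm ((F h ^^ m) x - x - r *\<^sub>R y) \<le> e / 2 * r"
      using power_first_order[OF xy e] by blast
    have "\<forall>\<^sub>F r in at_right 0. r < d"
      using d by (intro order_tendstoD(2)[OF tendsto_ident_at])
    with eventually_at_right_less[of 0]
    show "\<forall>\<^sub>F r in at_right 0. dist ((S r x - x) /\<^sub>R r) y < e"
    proof eventually_elim
      case (elim r)
      have "norm (S r x - x - r *\<^sub>R y) \<le> e / 2 * r"
      proof (rule tendsto_upperbound)
        show "((\<lambda>h. norm ((F h ^^ steps r h) x - x - r *\<^sub>R y)) \<longlongrightarrow> norm (S r x - x - r *\<^sub>R y)) (at_right 0)"
          using elim by (intro tendsto_intros tendsto_S') simp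
        show "\<forall>\<^sub>F h in at_right 0. norm ((F h ^^ steps r h) x - x - r *\<^sub>R y) \<le> e / 2 * r"
          using D[OF elim] eventually_at_right_less[of 0]
        proof eventually_elim
          case (elim h)
          then have "\<bar>real (steps r h) * h - r\<bar> \<le> h"
            using steps_bounds[of h r] \<open>0 < r\<close> by auto
          then show ?case using elim(1) by blast
        qed
      qed simp
      moreover have "(S r x - x) /\<^sub>R r - y = (S r x - x - r *\<^sub>R y) /\<^sub>R r"
        using elim by (simp add: scaleR_right_diff_distrib)
      ultimately have "norm ((S r x - x) /\<^sub>R r - y) \<le> e / 2"
        using elim by (simp add: divide_inverse_commute[symmetric] pos_divide_le_eq)
      then show ?case using e by (simp add: dist_norm)
    qed
  qed
  then show "(x, y) \<in> strong_deriv0 S"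
    by (simp add: strong_deriv0_def S_0)
qed

text \<open>For \<open>x\<close> in \<open>A\<close>, integrating the solution inside the closed
  graph gives \<open>(J t x, S t x - x)\<close> in \<open>V\<close>; density and continuity in
  \<open>x\<close> extend this to all \<open>x\<close>. Division by \<open>t\<close> and
  \<open>t\<close> tending to \<open>0\<close> turn this pair into \<open>(x, y)\<close>.\<close>

lemma strong_deriv0_S_subset:
  assumes V: "subspace V" "closed V" "V \<subseteq> closure (strong_deriv0 F)"
    and A: "closure A = UNIV" and l: "0 < l"
    and sol: "\<And>x. x \<in> A \<Longrightarrow> \<exists>f. local_solution V l x f"
  shows "strong_deriv0 S \<subseteq> V"
proof -
  define J where "J t x = integral {0..t} (\<lambda>s. S s x)" for t x
  have cont: "continuous_on {0..t} (\<lambda>s. S s x)" for t x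
    using continuous_S by (rule continuous_on_subset) auto
  have J_deriv: "((\<lambda>t. J t x) has_vector_derivative S s x) (at s within {0..t})" if "s \<in> {0..t}" for s t x
    unfolding J_def using cont that by (rule integral_has_vector_derivative)
  have on_A: "(J t x, S t x - x) \<in> V" if t: "0 \<le> t" "t < l" and x: "x \<in> A" for t x
  proof -
    obtain f where f: "local_solution V l x f" using sol[OF x] by blast
    have f0: "f 0 = x" using f by (simp add: local_solution_def)
    have f_eq: "S s x = f s" if "s \<in> {0..<l}" for s
      unfolding f0[symmetric]
      by (intro S_eqI solution_limit[of l f s] that) (use f V(3) in \<open>fastforce simp: local_solution_def\<close>)
    \<comment> \<open>On \<open>{0..t}\<close> the path \<open>\<phi>\<close> has derivative
      \<open>(S s x, y) = (f s, y)\<close>, a point of \<open>V\<close>, so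
      \<open>increment_in_closed_subspace\<close> applies in the product space.\<close>
    define \<phi> where "\<phi> s = (J s x, f s)" for s
    have "\<phi> t - \<phi> 0 \<in> V"
    proof (rule increment_in_closed_subspace[OF V(1,2) t(1)])
      fix s assume s: "s \<in> {0..t}"
      then obtain y where y: "(f s, y) \<in> V" "(f has_vector_derivative y) (at s within {0..<l})"
        using f t unfolding local_solution_def by (metis atLeastAtMost_iff atLeastLessThan_iff le_less_trans)
      have "(f has_vector_derivative y) (at s within {0..t})"
        using y(2) by (rule has_vector_derivative_within_subset) (use t in auto)
      then have "(\<phi> has_vector_derivative (S s x, y)) (at s within {0..t})"
        unfolding \<phi>_def using J_deriv[OF s] by (intro has_vector_derivative_Pair)
      then show "\<exists>v\<in>V. (\<phi> has_vector_derivative v) (at s within {0..t})"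
        using y(1) f_eq[of s] s t by auto
    qed
    then show ?thesis using f_eq[of t] t f0 by (simp add: \<phi>_def J_def)
  qed
  have all: "(J t x, S t x - x) \<in> V" if t: "0 \<le> t" "t < l" for t x
  proof -
    have "x \<in> closure A" by (simp add: A)
    then obtain a where a: "\<And>n. a n \<in> A" and lim: "a \<longlonglongrightarrow> x"
      unfolding closure_sequential by blast
    have "(\<lambda>n. J t (a n)) \<longlonglongrightarrow> J t x"
    proof (rule LIM_zero_cancel, rule Lim_null_comparison)
      show "\<forall>\<^sub>F n in sequentially. norm (J t (a n) - J t x) \<le> (bnd t * norm (a n - x)) * (t - 0)"
      proof (rule always_eventually, rule allI)
        fix n
        have "J t (a n) - J t x = integral {0..t} (\<lambda>s. S s (a n) - S s x)"
          unfolding J_def by (intro integral_diff[symmetric] integrable_continuous_real cont)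
        also have "\<dots> = integral {0..t} (\<lambda>s. S s (a n - x))"
          by (intro integral_cong) (simp add: linear_diff[OF bounded_linear.linear[OF bounded_linear_S]])
        finally show "norm (J t (a n) - J t x) \<le> (bnd t * norm (a n - x)) * (t - 0)"
          using integral_bound[OF t(1) cont, of "a n - x" "bnd t * norm (a n - x)"] norm_S_le by simp
      qed
      have "(\<lambda>n. (bnd t * norm (a n - x)) * (t - 0)) \<longlonglongrightarrow> (bnd t * norm (x - x)) * (t - 0)"
        by (intro tendsto_intros lim)
      then show "(\<lambda>n. (bnd t * norm (a n - x)) * (t - 0)) \<longlonglongrightarrow> 0" by simp
    qed
    moreover have "(\<lambda>n. S t (a n) - a n) \<longlonglongrightarrow> S t x - x"
      by (intro tendsto_diff lim bounded_linear.tendsto[OF bounded_linear_S] t)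
    ultimately have "(\<lambda>n. (J t (a n), S t (a n) - a n)) \<longlonglongrightarrow> (J t x, S t x - x)"
      by (rule tendsto_Pair)
    then show ?thesis
      by (rule closed_sequentially[OF V(2) on_A[OF t a]])
  qed
  show ?thesis
  proof clarify
    fix x y assume "(x, y) \<in> strong_deriv0 S"
    then have y: "((\<lambda>t. (S t x - x) /\<^sub>R t) \<longlongrightarrow> y) (at_right 0)"
      by (simp add: strong_deriv0_def S_0)
    \<comment> \<open>The averages converge because the derivative of \<open>J\<close> at time
      \<open>0\<close> is \<open>S 0 x = x\<close>.\<close>
    have "((\<lambda>t. J t x /\<^sub>R t) \<longlongrightarrow> x) (at_right 0)"
    proof (rule tendstoI)
      fix e :: real assume e: "0 < e"
      have "((\<lambda>t. J t x) has_vector_derivative x) (at 0 within {0..1})"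
        using J_deriv[of 0 1 x] by (simp add: S_0)
      then obtain d where d: "0 < d" and D: "\<And>p. p \<in> {0..1} \<Longrightarrow> \<bar>p - 0\<bar> < d \<Longrightarrow>
          norm (J p x - J 0 x - (p - 0) *\<^sub>R x) \<le> e / 2 * \<bar>p - 0\<bar>"
        using e by (elim has_vector_derivative_approx[where e = "e / 2"]) auto
      have "\<forall>\<^sub>F r in at_right (0::real). r < min d 1"
        using d by (intro order_tendstoD(2)[OF tendsto_ident_at]) simp
      with eventually_at_right_less[of 0]
      show "\<forall>\<^sub>F r in at_right 0. dist (J r x /\<^sub>R r) x < e"
      proof eventually_elim
        case (elim r)
        then have "norm (J r x - r *\<^sub>R x) \<le> e / 2 * r"
          using D[of r] by (simp add: J_def)
        moreover have "J r x /\<^sub>R r - x = (J r x - r *\<^sub>R x) /\<^sub>R r"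
          using elim by (simp add: scaleR_right_diff_distrib)
        ultimately have "norm (J r x /\<^sub>R r - x) \<le> e / 2"
          using elim by (simp add: divide_inverse_commute[symmetric] pos_divide_le_eq)
        then show ?case using e by (simp add: dist_norm)
      qed
    qed
    with y have lim: "((\<lambda>t. (J t x /\<^sub>R t, (S t x - x) /\<^sub>R t)) \<longlongrightarrow> (x, y)) (at_right 0)"
      by (intro tendsto_Pair)
    have "\<forall>\<^sub>F t in at_right (0::real). t < l"
      using l by (intro order_tendstoD(2)[OF tendsto_ident_at])
    with eventually_at_right_less[of 0]
    have "\<forall>\<^sub>F t in at_right 0. (J t x /\<^sub>R t, (S t x - x) /\<^sub>R t) \<in> V"
    proof eventually_elim
      case (elim t)
      then show ?case
        using subspace_scale[OF V(1) all[of t x], of "inverse t"] by simp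
    qed
    then show "(x, y) \<in> V"
      by (rule Lim_in_closed_set[OF V(2) _ _ lim]) simp
  qed
qed

lemma chernoff_limit:
  assumes t: "0 \<le> t"
  shows "(\<lambda>n. (F (t / real n) ^^ n) x) \<longlonglongrightarrow> S t x"
proof (cases "t = 0")
  \<comment> \<open>Here \<open>t / n\<close> stays at \<open>0\<close> and does not approach it
    from the right, so this case rests on \<open>F 0 = id\<close> directly.\<close>
  case True
  then show ?thesis by (simp add: F_0 S_0)
next
  case False
  then have t': "0 < t" using t by simp
  have "((\<lambda>n. t / real n) \<longlongrightarrow> 0) sequentially"
    by (intro real_tendsto_divide_at_top[OF tendsto_const] filterlim_real_sequentially)
  moreover have "\<forall>\<^sub>F n in sequentially. t / real n \<in> {0<..} \<and> t / real n \<noteq> 0"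
    using eventually_gt_at_top[of 0] by eventually_elim (use t' in simp)
  ultimately have "filterlim (\<lambda>n. t / real n) (at_right 0) sequentially"
    by (simp add: filterlim_at)
  from filterlim_compose[OF tendsto_S'[OF t] this]
  have "(\<lambda>n. (F (t / real n) ^^ steps t (t / real n)) x) \<longlonglongrightarrow> S t x" .
  then show ?thesis
  proof (rule Lim_transform_eventually)
    show "\<forall>\<^sub>F n in sequentially. (F (t / real n) ^^ steps t (t / real n)) x = (F (t / real n) ^^ n) x"
      using eventually_gt_at_top[of 0] by eventually_elim (use t' in \<open>simp add: steps_def\<close>)
  qed
qed

end

section \<open>Linearity over the scalar field\<close>

context banach_space_over
begin

lemma smul_scaleR: "smul c (r *\<^sub>R x) = r *\<^sub>R smul c x"
  by (metis mult.commute scale_of_real scale_scale)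

lemma bounded_linear_smul: "bounded_linear (smul c)"
  by (rule bounded_linear_intro[of _ "norm c"])
     (simp_all add: scale_right_distrib smul_scaleR norm_scale mult.commute)

text \<open>Applied to the limit semigroup, whose derivative at \<open>0\<close> is the closure of
  \<open>Z\<close>, this is closability; single-valuedness is uniqueness of limits.\<close>

lemma linear_operator_strong_deriv0:
  assumes "\<And>t. 0 \<le> t \<Longrightarrow> bounded_operator smul (S t)"
  shows "linear_operator smul (strong_deriv0 S)"
  unfolding linear_operator_def
proof (intro conjI allI impI)
  have lin: "linear (S t)" and comm: "S t (smul c x) = smul c (S t x)" if "0 \<le> t" for t c x
    using assms[OF that] by (auto simp: bounded_operator_def bounded_linear.linear)
  show "single_valued (strong_deriv0 S)"
    unfolding single_valued_def strong_deriv0_def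
    by (auto intro: tendsto_unique[rotated])
  have "S t 0 = 0" if "0 \<le> t" for t using lin[OF that] by (rule linear_0)
  then have "\<forall>\<^sub>F h in at_right 0. (S h 0 - S 0 0) /\<^sub>R h = 0"
    using eventually_at_right_less[of 0] by (auto elim: eventually_mono)
  then show "(0, 0) \<in> strong_deriv0 S"
    unfolding strong_deriv0_def by (simp only: mem_Collect_eq case_prod_conv tendsto_eventually)
  fix x y assume xy: "(x, y) \<in> strong_deriv0 S"
  show "(x + u, y + v) \<in> strong_deriv0 S" if uv: "(u, v) \<in> strong_deriv0 S" for u v
  proof -
    have "((\<lambda>h. (S h x - S 0 x) /\<^sub>R h + (S h u - S 0 u) /\<^sub>R h) \<longlongrightarrow> y + v) (at_right 0)"
      using xy uv by (intro tendsto_add) (auto simp: strong_deriv0_def)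
    moreover have "\<forall>\<^sub>F h in at_right 0. (S h x - S 0 x) /\<^sub>R h + (S h u - S 0 u) /\<^sub>R h
        = (S h (x + u) - S 0 (x + u)) /\<^sub>R h"
      using eventually_at_right_less[of 0]
      by eventually_elim (simp add: linear_add[OF lin] algebra_simps)
    ultimately show ?thesis
      by (auto simp: strong_deriv0_def intro: Lim_transform_eventually)
  qed
  show "(smul c x, smul c y) \<in> strong_deriv0 S" for c
  proof -
    have "((\<lambda>h. smul c ((S h x - S 0 x) /\<^sub>R h)) \<longlongrightarrow> smul c y) (at_right 0)"
      using xy by (intro bounded_linear.tendsto[OF bounded_linear_smul]) (auto simp: strong_deriv0_def)
    moreover have "\<forall>\<^sub>F h in at_right 0. smul c ((S h x - S 0 x) /\<^sub>R h)
        = (S h (smul c x) - S 0 (smul c x)) /\<^sub>R h"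
      using eventually_at_right_less[of 0]
      by eventually_elim (simp add: comm smul_scaleR scale_right_diff_distrib)
    ultimately show ?thesis
      by (auto simp: strong_deriv0_def intro: Lim_transform_eventually)
  qed
qed

end

lemma subspace_linear_operator:
  assumes smul: "banach_space_over smul" and T: "linear_operator smul T"
  shows "subspace T"
proof (rule subspaceI)
  show "0 \<in> T" using T by (simp add: linear_operator_def zero_prod_def)
  show "u + v \<in> T" if "u \<in> T" "v \<in> T" for u v
    using T that by (cases u; cases v) (auto simp: linear_operator_def)
  show "r *\<^sub>R u \<in> T" if "u \<in> T" for r u
    using T that by (cases u) (metis linear_operator_def scaleR_Pair banach_space_over.scale_of_real[OF smul])
qed

lemma subspace_closure:
  fixes V :: "'a::real_normed_vector set"
  assumes "subspace V"
  shows "subspace (closure V)"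
proof (rule subspaceI)
  show "0 \<in> closure V" using subspace_0[OF assms] closure_subset by blast
next
  fix x y assume "x \<in> closure V" "y \<in> closure V"
  then obtain u v where "\<And>n. u n \<in> V" "u \<longlonglongrightarrow> x" "\<And>n. v n \<in> V" "v \<longlonglongrightarrow> y"
    unfolding closure_sequential by blast
  then have "\<forall>n. u n + v n \<in> V" "(\<lambda>n. u n + v n) \<longlonglongrightarrow> x + y"
    using assms by (auto intro: subspace_add tendsto_add)
  then show "x + y \<in> closure V" unfolding closure_sequential by (intro exI conjI)
next
  fix c x assume "x \<in> closure V"
  then obtain u where "\<And>n. u n \<in> V" "u \<longlonglongrightarrow> x"
    unfolding closure_sequential by blast
  then have "\<forall>n. c *\<^sub>R u n \<in> V" "(\<lambda>n. c *\<^sub>R u n) \<longlonglongrightarrow> c *\<^sub>R x"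
    using assms by (auto intro: subspace_scale tendsto_intros)
  then show "c *\<^sub>R x \<in> closure V" unfolding closure_sequential by (intro exI conjI)
qed

section \<open>Assembling the theorem\<close>

lemma class_F_chernoff_function:
  fixes F :: "real \<Rightarrow> 'x::banach \<Rightarrow> 'x"
  assumes "F \<in> class_F smul"
  obtains M c where "chernoff_function F M c"
proof -
  obtain M a where M: "1 \<le> M"
    and bound: "\<And>n m s. 1 \<le> n \<Longrightarrow> 1 \<le> m \<Longrightarrow> 0 \<le> s \<Longrightarrow>
        onorm (F (s / real n) ^^ m) \<le> M * exp (a * real m / real n * s)"
    and F: "\<And>s. 0 \<le> s \<Longrightarrow> bounded_linear (F s)" "F 0 = id" "closure (Domain (strong_deriv0 F)) = UNIV"
    using assms unfolding class_F_def bounded_operator_def mem_Collect_eq by metis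
  have "norm ((F h ^^ m) x) \<le> M * exp (max a 0 * (real m * h)) * norm x" if h: "0 \<le> h" for h m x
  proof (cases "m = 0")
    case True
    then show ?thesis using M mult_right_mono[of 1 M "norm x"] by simp
  next
    case False
    \<comment> \<open>The instance \<open>n = 1\<close>, \<open>s = h\<close> of the bound; raising
      \<open>a\<close> to \<open>max a 0\<close> then makes it monotone in the elapsed time.\<close>
    have "onorm (F h ^^ m) \<le> M * exp (a * (real m * h))"
      using bound[of 1 m h] False h by (simp add: mult.assoc)
    also have "\<dots> \<le> M * exp (max a 0 * (real m * h))"
      using M h by (intro mult_left_mono) (auto intro: mult_right_mono)
    finally show ?thesis
      using onorm[OF bounded_linear_funpow[OF F(1)[OF h]], of m x]
      by (meson mult_right_mono norm_ge_zero order_trans)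
  qed
  then have "chernoff_function F M (max a 0)"
    using M F by (intro chernoff_function.intro) auto
  then show ?thesis by (rule that)
qed

theorem theorem5p1:
  fixes smul :: "'k::real_normed_field \<Rightarrow> 'x::banach \<Rightarrow> 'x"
    and F :: "real \<Rightarrow> 'x \<Rightarrow> 'x"
    and Z :: "('x \<times> 'x) set"
    and A :: "'x set"
    and l :: real
  assumes "banach_space_over smul"
    and "F \<in> class_F smul"
    and "linear_operator smul Z"
    and "Z \<subseteq> strong_deriv0 F"
    and "A \<subseteq> Domain Z"
    and "module.subspace smul A"
    and "closure A = UNIV"
    and "l > 0"
    and "\<forall>f0\<in>A. \<exists>f. local_solution (closure Z) l f0 f"
  shows "closable smul Z \<and>
    (\<exists>S. C0_semigroup smul S \<and> is_generator_of (closure Z) S \<and>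
      (\<forall>f. \<forall>t\<ge>0. (\<lambda>n. (F (t / real n) ^^ n) f) \<longlonglongrightarrow> S t f))"
proof -
  interpret banach_space_over smul by fact
  obtain M c where "chernoff_function F M c"
    using class_F_chernoff_function[OF assms(2)] .
  then interpret chernoff_function F M c .
  \<comment> \<open>Closability is still open here, so the closure is handled as a closed real
    subspace of the product space. That it is single-valued follows at the end from its equality
    with \<open>strong_deriv0 S\<close>.\<close>
  define V where "V = closure Z"
  have V: "Real_Vector_Spaces.subspace V" "closed V" "V \<subseteq> closure (strong_deriv0 F)"
    unfolding V_def
    using subspace_linear_operator[OF assms(1,3)] closure_mono[OF assms(4)]
    by (auto intro: subspace_closure)
  have sol: "\<exists>f. local_solution V l x f" if "x \<in> A" for x
    using assms(9) that by (simp add: V_def)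
  have "convergent_at t" if t: "t \<in> {0..<l}" for t
  proof (rule convergent_at_dense[OF _ assms(7)])
    fix x assume "x \<in> A"
    then obtain f where f: "local_solution V l x f" using sol by blast
    have "((\<lambda>h. (F h ^^ steps t h) (f 0)) \<longlongrightarrow> f t) (at_right 0)"
      by (intro solution_limit[of l f t] t) (use f V(3) in \<open>fastforce simp: local_solution_def\<close>)
    then show "\<exists>y. ((\<lambda>h. (F h ^^ steps t h) x) \<longlongrightarrow> y) (at_right 0)"
      using f by (auto simp: local_solution_def)
  qed (use t in simp)
  then have "convergent_at t" if "0 \<le> t" for t
    using convergent_at_extend[OF assms(8)] that by blast
  then interpret convergent_chernoff_function F M c by unfold_locales
  \<comment> \<open>A cycle of inclusions: \<open>V\<close> lies in the closure of
    \<open>strong_deriv0 F\<close>, this lies in \<open>strong_deriv0 S\<close>, and that lies in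
    \<open>V\<close>.\<close>
  have gen: "V = strong_deriv0 S"
    using closure_strong_deriv0_subset strong_deriv0_S_subset[OF V assms(7,8) sol] V(3) by blast
  have F_smul: "F h (smul a x) = smul a (F h x)" if "0 \<le> h" for h a x
    using assms(2) that by (simp add: class_F_def bounded_operator_def)
  have S_bounded: "bounded_operator smul (S t)" if "0 \<le> t" for t
    unfolding bounded_operator_def
    using bounded_linear_S[OF that] S_commute[OF bounded_linear_smul F_smul that] by blast
  have "C0_semigroup smul S"
    unfolding C0_semigroup_def
    using S_bounded S_0 S_add_time continuous_S by (auto simp: fun_eq_iff)
  moreover have "closable smul Z"
    unfolding closable_def V_def[symmetric] gen using S_bounded by (rule linear_operator_strong_deriv0)
  moreover have "is_generator_of (closure Z) S"
    using gen by (simp add: is_generator_of_def V_def)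
  ultimately show ?thesis using chernoff_limit by blast
qed

end
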